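(* Let $\mathcal{A},\mathcal{B},\mathcal{C}$ be categories. The conjugation maps $j_{\mathrm{l}}\colon\mathrm{Nat}(T,T')\to\mathrm{Nat}(H',H)$ and $j_{\mathrm{r}}\colon\mathrm{Nat}(H',H)\to\mathrm{Nat}(T,T')$, for left-sided adjunctions of two variables $T\dashv_{\mathrm{L}}H$ and $T'\dashv_{\mathrm{L}}H'$ with $T,T'\colon\mathcal{A}\times\mathcal{B}\to\mathcal{C}$ and $H,H'\colon\mathcal{A}^{\mathrm{op}}\times\mathcal{C}\to\mathcal{B}$, form an identity-on-objects isomorphism of categories $$\mathcal{A}\mathrm{dj}^{\mathrm{2L}}_{\mathrm{l}}\;\cong\;\mathcal{A}\mathrm{dj}^{\mathrm{2L}}_{\mathrm{r}}$$ with $j_{\mathrm{l}}$ giving the functor from left to right and $j_{\mathrm{r}}$ its inverse.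
   Context: A left-sided adjunction of two variables $T\dashv_{\mathrm{L}}H$ consists of functors $T\colon\mathcal{A}\times\mathcal{B}\to\mathcal{C}$ and $H\colon\mathcal{A}^{\mathrm{op}}\times\mathcal{C}\to\mathcal{B}$ and families of morphisms $\epsilon_{a,c}\colon T(a,H(a,c))\to c$ (counit) and $\eta_{a,b}\colon b\to H(a,T(a,b))$ (unit) such that: $\epsilon_{a,c}$ is natural in $c$ and $\eta_{a,b}$ is natural in $b$; they are extranatural in $a$, meaning that for every $f\colon a\to a'$ in $\mathcal{A}$, $\epsilon_{a,c}\circ T(a,H(f,c))=\epsilon_{a',c}\circ T(f,H(a',c))$ and $H(f,T(a',b))\circ\eta_{a',b}=H(a,T(f,b))\circ\eta_{a,b}$; and the triangle identities $H(a,\epsilon_{a,c})\circ\eta_{a,H(a,c)}=\mathrm{id}_{H(a,c)}$ and $\epsilon_{a,T(a,b)}\circ T(a,\eta_{a,b})=\mathrm{id}_{T(a,b)}$ hold. Categories: $\mathcal{A}\mathrm{dj}^{\mathrm{2L}}_{\mathrm{l}}$ has as objects the left-sided adjunctions of two variables $T\dashv_{\mathrm{L}}H$, with morphisms from $T\dashv_{\mathrm{L}}H$ to $T'\dashv_{\mathrm{L}}H'$ the set $\mathrm{Nat}(T,T')$ and the usual composition of natural transformations. $\mathcal{A}\mathrm{dj}^{\mathrm{2L}}_{\mathrm{r}}$ has the same objects, with morphisms from $T\dashv_{\mathrm{L}}H$ to $T'\dashv_{\mathrm{L}}H'$ the set $\mathrm{Nat}(H',H)$, composition being the reverse of composition of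 natural transformations. Conjugation: with $(\epsilon,\eta)$ and $(\epsilon',\eta')$ the counits and units of $T\dashv_{\mathrm{L}}H$ and $T'\dashv_{\mathrm{L}}H'$, for $\theta\colon T\Rightarrow T'$, $j_{\mathrm{l}}(\theta)\colon H'\Rightarrow H$ has components $$H'(a,c)\xrightarrow{\eta_{a,H'(a,c)}}H(a,T(a,H'(a,c)))\xrightarrow{H(a,\theta_{a,H'(a,c)})}H(a,T'(a,H'(a,c)))\xrightarrow{H(a,\epsilon'_{a,c})}H(a,c).$$ For $\phi\colon H'\Rightarrow H$, $j_{\mathrm{r}}(\phi)\colon T\Rightarrow T'$ has components $$T(a,b)\xrightarrow{T(a,\eta'_{a,b})}T(a,H'(a,T'(a,b)))\xrightarrow{T(a,\phi_{a,T'(a,b)})}T(a,H(a,T'(a,b)))\xrightarrow{\epsilon_{a,T'(a,b)}}T'(a,b).$$ *)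

theory Defs
  imports Main "HOL-Library.FuncSet"
begin

section \<open>Categories, functors, natural transformations\<close>

text \<open>
  Object maps, arrow maps and families of morphisms are extensional
  (\<^const>\<open>undefined\<close> outside their domain), so that equality in HOL
  is equality of the mathematical objects.
\<close>

record ('o, 'm) cat =
  Obj :: "'o set"
  Arr :: "'m set"
  Dom :: "'m \<Rightarrow> 'o"
  Cod :: "'m \<Rightarrow> 'o"
  Id :: "'o \<Rightarrow> 'm"
  Comp :: "'m \<Rightarrow> 'm \<Rightarrow> 'm"  (infixr "\<cdot>\<index>" 70)

definition hom :: "('o, 'm) cat \<Rightarrow> 'o \<Rightarrow> 'o \<Rightarrow> 'm set" where
  "hom C a b = {f \<in> Arr C. Dom C f = a \<and> Cod C f = b}"

locale category =
  fixes C :: "('o, 'm) cat" (structure)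
  assumes Dom_in_Obj: "f \<in> Arr C \<Longrightarrow> Dom C f \<in> Obj C"
    and Cod_in_Obj: "f \<in> Arr C \<Longrightarrow> Cod C f \<in> Obj C"
    and Id_in_hom: "a \<in> Obj C \<Longrightarrow> Id C a \<in> hom C a a"
    and Comp_in_hom: "f \<in> hom C a b \<Longrightarrow> g \<in> hom C b c \<Longrightarrow> g \<cdot> f \<in> hom C a c"
    and Comp_Id: "f \<in> hom C a b \<Longrightarrow> f \<cdot> Id C a = f"
    and Id_Comp: "f \<in> hom C a b \<Longrightarrow> Id C b \<cdot> f = f"
    and Comp_assoc: "f \<in> hom C a b \<Longrightarrow> g \<in> hom C b c \<Longrightarrow> h \<in> hom C c d
      \<Longrightarrow> (h \<cdot> g) \<cdot> f = h \<cdot> (g \<cdot> f)"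

definition op_cat :: "('o, 'm) cat \<Rightarrow> ('o, 'm) cat" where
  "op_cat C = \<lparr>Obj = Obj C, Arr = Arr C, Dom = Cod C, Cod = Dom C, Id = Id C,
    Comp = (\<lambda>g f. f \<cdot>\<^bsub>C\<^esub> g)\<rparr>"

definition prod_cat :: "('o, 'm) cat \<Rightarrow> ('p, 'n) cat \<Rightarrow> ('o \<times> 'p, 'm \<times> 'n) cat" where
  "prod_cat C D = \<lparr>Obj = Obj C \<times> Obj D, Arr = Arr C \<times> Arr D,
    Dom = (\<lambda>(f, g). (Dom C f, Dom D g)),
    Cod = (\<lambda>(f, g). (Cod C f, Cod D g)),
    Id = (\<lambda>(a, b). (Id C a, Id D b)),
    Comp = (\<lambda>(f', g') (f, g). (f' \<cdot>\<^bsub>C\<^esub> f, g' \<cdot>\<^bsub>D\<^esub> g))\<rparr>"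

record ('o, 'm, 'p, 'n) ftr =
  OMap :: "'o \<Rightarrow> 'p"
  AMap :: "'m \<Rightarrow> 'n"

locale cat_functor =
  source: category C + target: category D
  for C :: "('o, 'm) cat" and D :: "('p, 'n) cat" +
  fixes F :: "('o, 'm, 'p, 'n) ftr"
  assumes OMap_funcset: "OMap F \<in> Obj C \<rightarrow>\<^sub>E Obj D"
    and AMap_extensional: "AMap F \<in> extensional (Arr C)"
    and AMap_in_hom: "f \<in> hom C a b \<Longrightarrow> AMap F f \<in> hom D (OMap F a) (OMap F b)"
    and AMap_Id: "a \<in> Obj C \<Longrightarrow> AMap F (Id C a) = Id D (OMap F a)"
    and AMap_Comp: "f \<in> hom C a b \<Longrightarrow> g \<in> hom C b c
      \<Longrightarrow> AMap F (g \<cdot>\<^bsub>C\<^esub> f) = AMap F g \<cdot>\<^bsub>D\<^esub> AMap F f"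

definition id_ftr :: "('o, 'm) cat \<Rightarrow> ('o, 'm, 'o, 'm) ftr" where
  "id_ftr C = \<lparr>OMap = (\<lambda>a\<in>Obj C. a), AMap = (\<lambda>f\<in>Arr C. f)\<rparr>"

definition comp_ftr ::
  "('o, 'm) cat \<Rightarrow> ('p, 'n, 'q, 'k) ftr \<Rightarrow> ('o, 'm, 'p, 'n) ftr \<Rightarrow> ('o, 'm, 'q, 'k) ftr" where
  "comp_ftr C G F = \<lparr>OMap = compose (Obj C) (OMap G) (OMap F),
    AMap = compose (Arr C) (AMap G) (AMap F)\<rparr>"

definition inverse_functors ::
  "('o, 'm) cat \<Rightarrow> ('p, 'n) cat \<Rightarrow> ('o, 'm, 'p, 'n) ftr \<Rightarrow> ('p, 'n, 'o, 'm) ftr \<Rightarrow> bool" where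
  "inverse_functors C D F G \<longleftrightarrow> cat_functor C D F \<and> cat_functor D C G \<and>
    comp_ftr C G F = id_ftr C \<and> comp_ftr D F G = id_ftr D"

definition Nat :: "('o, 'm) cat \<Rightarrow> ('p, 'n) cat \<Rightarrow>
    ('o, 'm, 'p, 'n) ftr \<Rightarrow> ('o, 'm, 'p, 'n) ftr \<Rightarrow> ('o \<Rightarrow> 'n) set" where
  "Nat C D F G = {\<theta> \<in> extensional (Obj C).
    (\<forall>a\<in>Obj C. \<theta> a \<in> hom D (OMap F a) (OMap G a)) \<and>
    (\<forall>a\<in>Obj C. \<forall>b\<in>Obj C. \<forall>f\<in>hom C a b. \<theta> b \<cdot>\<^bsub>D\<^esub> AMap F f = AMap G f \<cdot>\<^bsub>D\<^esub> \<theta> a)}"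

definition nat_id :: "('o, 'm) cat \<Rightarrow> ('p, 'n) cat \<Rightarrow> ('o, 'm, 'p, 'n) ftr \<Rightarrow> 'o \<Rightarrow> 'n" where
  "nat_id C D F = (\<lambda>a\<in>Obj C. Id D (OMap F a))"

definition nat_comp ::
  "('o, 'm) cat \<Rightarrow> ('p, 'n) cat \<Rightarrow> ('o \<Rightarrow> 'n) \<Rightarrow> ('o \<Rightarrow> 'n) \<Rightarrow> 'o \<Rightarrow> 'n" where
  "nat_comp C D \<psi> \<theta> = (\<lambda>a\<in>Obj C. \<psi> a \<cdot>\<^bsub>D\<^esub> \<theta> a)"

section \<open>Left-sided adjunctions of two variables\<close>

text \<open>
  The action of a two-variable functor on a morphism in one variable only, written
  \<open>T(a, g)\<close> informally, is its action on the pair \<open>(Id A a, g)\<close>. The category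
  \<open>op_cat A\<close> has the same arrows as \<open>A\<close>, so that \<open>f : a \<rightarrow> a'\<close> in \<open>A\<close> is also the
  arrow \<open>a' \<rightarrow> a\<close> on which \<open>H\<close> acts, giving \<open>H(f, c) : H(a', c) \<rightarrow> H(a, c)\<close>.
\<close>

record ('a, 'ma, 'b, 'mb, 'c, 'mc) adj2L =
  TF :: "('a \<times> 'b, 'ma \<times> 'mb, 'c, 'mc) ftr"
  HF :: "('a \<times> 'c, 'ma \<times> 'mc, 'b, 'mb) ftr"
  counit :: "'a \<times> 'c \<Rightarrow> 'mc"
  unit :: "'a \<times> 'b \<Rightarrow> 'mb"

locale left_sided_adjunction =
  T: cat_functor "prod_cat A B" C "TF X" + H: cat_functor "prod_cat (op_cat A) C" B "HF X"
  for A :: "('a, 'ma) cat" and B :: "('b, 'mb) cat" and C :: "('c, 'mc) cat"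
    and X :: "('a, 'ma, 'b, 'mb, 'c, 'mc) adj2L" +
  assumes counit_extensional: "counit X \<in> extensional (Obj A \<times> Obj C)"
    and unit_extensional: "unit X \<in> extensional (Obj A \<times> Obj B)"
    and counit_in_hom: "a \<in> Obj A \<Longrightarrow> c \<in> Obj C
      \<Longrightarrow> counit X (a, c) \<in> hom C (OMap (TF X) (a, OMap (HF X) (a, c))) c"
    and unit_in_hom: "a \<in> Obj A \<Longrightarrow> b \<in> Obj B
      \<Longrightarrow> unit X (a, b) \<in> hom B b (OMap (HF X) (a, OMap (TF X) (a, b)))"
    and counit_natural: "a \<in> Obj A \<Longrightarrow> g \<in> hom C c c'
      \<Longrightarrow> counit X (a, c') \<cdot>\<^bsub>C\<^esub> AMap (TF X) (Id A a, AMap (HF X) (Id A a, g))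
        = g \<cdot>\<^bsub>C\<^esub> counit X (a, c)"
    and unit_natural: "a \<in> Obj A \<Longrightarrow> h \<in> hom B b b'
      \<Longrightarrow> unit X (a, b') \<cdot>\<^bsub>B\<^esub> h
        = AMap (HF X) (Id A a, AMap (TF X) (Id A a, h)) \<cdot>\<^bsub>B\<^esub> unit X (a, b)"
    and counit_extranatural: "f \<in> hom A a a' \<Longrightarrow> c \<in> Obj C
      \<Longrightarrow> counit X (a, c) \<cdot>\<^bsub>C\<^esub> AMap (TF X) (Id A a, AMap (HF X) (f, Id C c))
        = counit X (a', c) \<cdot>\<^bsub>C\<^esub> AMap (TF X) (f, Id B (OMap (HF X) (a', c)))"
    and unit_extranatural: "f \<in> hom A a a' \<Longrightarrow> b \<in> Obj B
      \<Longrightarrow> AMap (HF X) (f, Id C (OMap (TF X) (a', b))) \<cdot>\<^bsub>B\<^esub> unit X (a', b)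
        = AMap (HF X) (Id A a, AMap (TF X) (f, Id B b)) \<cdot>\<^bsub>B\<^esub> unit X (a, b)"
    and triangle_H: "a \<in> Obj A \<Longrightarrow> c \<in> Obj C
      \<Longrightarrow> AMap (HF X) (Id A a, counit X (a, c)) \<cdot>\<^bsub>B\<^esub> unit X (a, OMap (HF X) (a, c))
        = Id B (OMap (HF X) (a, c))"
    and triangle_T: "a \<in> Obj A \<Longrightarrow> b \<in> Obj B
      \<Longrightarrow> counit X (a, OMap (TF X) (a, b)) \<cdot>\<^bsub>C\<^esub> AMap (TF X) (Id A a, unit X (a, b))
        = Id C (OMap (TF X) (a, b))"

definition Nat_T where
  "Nat_T A B C X Y = Nat (prod_cat A B) C (TF X) (TF Y)"

text \<open>Here the transformations go backwards, from the \<open>H\<close>-functor of \<open>Y\<close> to that of \<open>X\<close>.\<close>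

definition Nat_H where
  "Nat_H A B C X Y = Nat (prod_cat (op_cat A) C) B (HF Y) (HF X)"

text \<open>
  A morphism carries its domain and codomain, \<open>(X, \<theta>, Y)\<close>, since different
  adjunctions may share the same functors.
\<close>

type_synonym ('o, 't) tagged = "'o \<times> 't \<times> 'o"

definition Adj_l :: "('a, 'ma) cat \<Rightarrow> ('b, 'mb) cat \<Rightarrow> ('c, 'mc) cat \<Rightarrow>
    (('a, 'ma, 'b, 'mb, 'c, 'mc) adj2L,
     (('a, 'ma, 'b, 'mb, 'c, 'mc) adj2L, 'a \<times> 'b \<Rightarrow> 'mc) tagged) cat" where
  "Adj_l A B C = \<lparr>
    Obj = {X. left_sided_adjunction A B C X},
    Arr = {(X, \<theta>, Y). left_sided_adjunction A B C X \<and> left_sided_adjunction A B C Y \<and>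
      \<theta> \<in> Nat_T A B C X Y},
    Dom = (\<lambda>(X, \<theta>, Y). X),
    Cod = (\<lambda>(X, \<theta>, Y). Y),
    Id = (\<lambda>X. (X, nat_id (prod_cat A B) C (TF X), X)),
    Comp = (\<lambda>(Y', \<psi>, Z) (X, \<theta>, Y). (X, nat_comp (prod_cat A B) C \<psi> \<theta>, Z))\<rparr>"

definition Adj_r :: "('a, 'ma) cat \<Rightarrow> ('b, 'mb) cat \<Rightarrow> ('c, 'mc) cat \<Rightarrow>
    (('a, 'ma, 'b, 'mb, 'c, 'mc) adj2L,
     (('a, 'ma, 'b, 'mb, 'c, 'mc) adj2L, 'a \<times> 'c \<Rightarrow> 'mb) tagged) cat" where
  "Adj_r A B C = \<lparr>
    Obj = {X. left_sided_adjunction A B C X},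
    Arr = {(X, \<phi>, Y). left_sided_adjunction A B C X \<and> left_sided_adjunction A B C Y \<and>
      \<phi> \<in> Nat_H A B C X Y},
    Dom = (\<lambda>(X, \<phi>, Y). X),
    Cod = (\<lambda>(X, \<phi>, Y). Y),
    Id = (\<lambda>X. (X, nat_id (prod_cat (op_cat A) C) B (HF X), X)),
    Comp = (\<lambda>(Y', \<psi>, Z) (X, \<phi>, Y). (X, nat_comp (prod_cat (op_cat A) C) B \<phi> \<psi>, Z))\<rparr>"

section \<open>Conjugation\<close>

definition conj_l :: "('a, 'ma) cat \<Rightarrow> ('b, 'mb) cat \<Rightarrow> ('c, 'mc) cat \<Rightarrow>
    ('a, 'ma, 'b, 'mb, 'c, 'mc) adj2L \<Rightarrow> ('a, 'ma, 'b, 'mb, 'c, 'mc) adj2L \<Rightarrow>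
    ('a \<times> 'b \<Rightarrow> 'mc) \<Rightarrow> ('a \<times> 'c \<Rightarrow> 'mb)" where
  "conj_l A B C X Y \<theta> = (\<lambda>(a, c) \<in> Obj A \<times> Obj C.
    AMap (HF X) (Id A a, counit Y (a, c)) \<cdot>\<^bsub>B\<^esub>
    AMap (HF X) (Id A a, \<theta> (a, OMap (HF Y) (a, c))) \<cdot>\<^bsub>B\<^esub>
    unit X (a, OMap (HF Y) (a, c)))"

definition conj_r :: "('a, 'ma) cat \<Rightarrow> ('b, 'mb) cat \<Rightarrow> ('c, 'mc) cat \<Rightarrow>
    ('a, 'ma, 'b, 'mb, 'c, 'mc) adj2L \<Rightarrow> ('a, 'ma, 'b, 'mb, 'c, 'mc) adj2L \<Rightarrow>
    ('a \<times> 'c \<Rightarrow> 'mb) \<Rightarrow> ('a \<times> 'b \<Rightarrow> 'mc)" where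
  "conj_r A B C X Y \<phi> = (\<lambda>(a, b) \<in> Obj A \<times> Obj B.
    counit X (a, OMap (TF Y) (a, b)) \<cdot>\<^bsub>C\<^esub>
    AMap (TF X) (Id A a, \<phi> (a, OMap (TF Y) (a, b))) \<cdot>\<^bsub>C\<^esub>
    AMap (TF X) (Id A a, unit Y (a, b)))"

definition J_l where
  "J_l A B C = \<lparr>OMap = (\<lambda>X \<in> Obj (Adj_l A B C). X),
    AMap = (\<lambda>(X, \<theta>, Y) \<in> Arr (Adj_l A B C). (X, conj_l A B C X Y \<theta>, Y))\<rparr>"

definition J_r where
  "J_r A B C = \<lparr>OMap = (\<lambda>X \<in> Obj (Adj_r A B C). X),
    AMap = (\<lambda>(X, \<phi>, Y) \<in> Arr (Adj_r A B C). (X, conj_r A B C X Y \<phi>, Y))\<rparr>"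

end

theory Submission
  imports Defs
begin

text \<open>
  For fixed \<open>a\<close>, unit and counit give mutually inverse transpositions: \<open>flat\<close> takes the arrows
  \<open>g : T(a, b) \<rightarrow> c\<close> to the arrows \<open>h : b \<rightarrow> H(a, c)\<close>, and \<open>sharp\<close> takes them back. Naturality and extranaturality of the unit make \<open>flat\<close> natural in \<open>b\<close>, \<open>c\<close> and \<open>a\<close>
  (\<open>flat_Comp_right\<close>, \<open>flat_Comp_left\<close>). A transformation \<open>\<theta> : T \<Rightarrow> T'\<close> acts by precomposition
  \<open>g \<mapsto> g \<theta>\<close> on arrows out of \<open>T'(a, b)\<close>; carried along the two transpositions, this is a map
  from arrows \<open>b \<rightarrow> H'(a, c)\<close> to arrows \<open>b \<rightarrow> H(a, c)\<close>, natural in \<open>b\<close>. By Yoneda it is postcomposition with exactly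
  one family \<open>\<phi> : H' \<Rightarrow> H\<close>, characterised by
  \<open>\<phi> \<cdot> flat' g = flat (g \<cdot> \<theta>)\<close> for all \<open>g\<close>, and evaluating at the universal arrow
  \<open>g = \<epsilon>'\<close>, the transpose of the identity of \<open>H'(a, c)\<close>, shows that \<open>\<phi>\<close> is the conjugate of \<open>\<theta>\<close>.
  Formally, \<open>X\<close> is the adjunction of \<open>T\<close> and \<open>H\<close>, and \<open>Y\<close> that of \<open>T'\<close> and \<open>H'\<close>.

  This description (\<open>conjugate\<close>) yields all claims. It is visibly satisfied by identities and stable
  under composition, so by uniqueness conjugation preserves both, contravariantly on the \<open>H\<close> side.
  It is also self-dual: passing to opposites in \<open>B\<close> and \<open>C\<close> makes \<open>H\<close> the left and \<open>T\<close> the right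
  functor of an adjunction, exchanging unit with counit, \<open>flat\<close> with \<open>sharp\<close> and \<open>j\<^sub>l\<close> with \<open>j\<^sub>r\<close>, and
  it turns the pair \<open>(\<theta>, \<phi>)\<close> into the conjugate pair \<open>(\<phi>, \<theta>)\<close>. Hence everything proved
  about \<open>j\<^sub>l\<close> holds for \<open>j\<^sub>r\<close>, and the two maps are mutually inverse.
\<close>

section \<open>Opposites, products and vertical composition\<close>

lemma op_cat_simps [simp]:
  "Obj (op_cat C) = Obj C" "Arr (op_cat C) = Arr C" "Dom (op_cat C) = Cod C"
  "Cod (op_cat C) = Dom C" "Id (op_cat C) = Id C" "Comp (op_cat C) g f = Comp C f g"
  by (simp_all add: op_cat_def)

lemma hom_op_cat [simp]: "hom (op_cat C) a b = hom C b a"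
  by (auto simp: hom_def)

lemma op_op_cat [simp]: "op_cat (op_cat C) = C"
  by (simp add: op_cat_def)

lemma op_prod_cat: "op_cat (prod_cat C D) = prod_cat (op_cat C) (op_cat D)"
  by (auto simp: op_cat_def prod_cat_def fun_eq_iff)

lemma prod_cat_simps [simp]:
  "Obj (prod_cat C D) = Obj C \<times> Obj D"
  "Id (prod_cat C D) (a, b) = (Id C a, Id D b)"
  "Comp (prod_cat C D) (f', g') (f, g) = (Comp C f' f, Comp D g' g)"
  by (simp_all add: prod_cat_def)

lemma hom_prod_cat [simp]: "hom (prod_cat C D) (a, b) (a', b') = hom C a a' \<times> hom D b b'"
  by (auto simp: hom_def prod_cat_def)

context category
begin

lemma hom_Obj: "f \<in> hom C a b \<Longrightarrow> a \<in> Obj C \<and> b \<in> Obj C"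
  using Dom_in_Obj Cod_in_Obj by (auto simp: hom_def)

lemma op: "category (op_cat C)"
  using Dom_in_Obj Cod_in_Obj Id_in_hom Comp_in_hom Comp_Id Id_Comp Comp_assoc
  by unfold_locales auto

end

lemma (in cat_functor) op: "cat_functor (op_cat C) (op_cat D) F"
  using OMap_funcset AMap_extensional AMap_in_hom AMap_Id AMap_Comp
  by (simp add: cat_functor_def cat_functor_axioms_def source.op target.op)

lemma Nat_op: "Nat (op_cat C) (op_cat D) F G = Nat C D G F"
  by (rule set_eqI, simp only: Nat_def mem_Collect_eq op_cat_simps hom_op_cat, safe)
    (rule sym, blast)+

lemma NatD:
  assumes "\<theta> \<in> Nat C D F G"
  shows "a \<in> Obj C \<Longrightarrow> \<theta> a \<in> hom D (OMap F a) (OMap G a)"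
    and "category C \<Longrightarrow> f \<in> hom C a b \<Longrightarrow> Comp D (\<theta> b) (AMap F f) = Comp D (AMap G f) (\<theta> a)"
    and "\<theta> \<in> extensional (Obj C)"
  using assms by (auto simp: Nat_def dest: category.hom_Obj)

lemma nat_id_in_Nat:
  assumes "cat_functor C D F"
  shows "nat_id C D F \<in> Nat C D F F"
proof -
  interpret F: cat_functor C D F by fact
  show ?thesis
    using F.target.Comp_Id[OF F.AMap_in_hom] F.target.Id_Comp[OF F.AMap_in_hom]
      PiE_mem[OF F.OMap_funcset] F.target.Id_in_hom
    by (simp add: Nat_def nat_id_def)
qed

lemma nat_comp_in_Nat:
  assumes "category C" "category D" "\<theta> \<in> Nat C D F G" "\<psi> \<in> Nat C D G K"
    and F: "cat_functor C D F" and G: "cat_functor C D G" and K: "cat_functor C D K"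
  shows "nat_comp C D \<psi> \<theta> \<in> Nat C D F K"
proof -
  interpret C: category C by fact
  interpret D: category D by fact
  note th = NatD[OF assms(3)] and ps = NatD[OF assms(4)]
  have "Comp D (Comp D (\<psi> b) (\<theta> b)) (AMap F f) = Comp D (AMap K f) (Comp D (\<psi> a) (\<theta> a))"
    if f: "f \<in> hom C a b" for a b f
  proof -
    have ab: "a \<in> Obj C" "b \<in> Obj C" using C.hom_Obj[OF f] by auto
    note maps = cat_functor.AMap_in_hom[OF F f] cat_functor.AMap_in_hom[OF G f]
      cat_functor.AMap_in_hom[OF K f]
    have "Comp D (Comp D (\<psi> b) (\<theta> b)) (AMap F f) = Comp D (\<psi> b) (Comp D (AMap G f) (\<theta> a))"
      using D.Comp_assoc[OF maps(1) th(1)[OF ab(2)] ps(1)[OF ab(2)]] th(2)[OF C.category_axioms f]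
      by simp
    also have "\<dots> = Comp D (Comp D (AMap K f) (\<psi> a)) (\<theta> a)"
      using D.Comp_assoc[OF th(1)[OF ab(1)] maps(2) ps(1)[OF ab(2)]] ps(2)[OF C.category_axioms f]
      by simp
    also have "\<dots> = Comp D (AMap K f) (Comp D (\<psi> a) (\<theta> a))"
      by (rule D.Comp_assoc[OF th(1)[OF ab(1)] ps(1)[OF ab(1)] maps(3)])
    finally show ?thesis .
  qed
  then show ?thesis
    using D.Comp_in_hom[OF th(1) ps(1)] by (simp add: Nat_def nat_comp_def)
qed

lemma nat_comp_id:
  assumes "category D" "\<theta> \<in> Nat C D F G"
  shows "nat_comp C D \<theta> (nat_id C D F) = \<theta>" "nat_comp C D (nat_id C D G) \<theta> = \<theta>"
  using NatD(3)[OF assms(2)] category.Comp_Id[OF assms(1) NatD(1)[OF assms(2)]]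
    category.Id_Comp[OF assms(1) NatD(1)[OF assms(2)]]
  by (auto simp: nat_comp_def nat_id_def fun_eq_iff extensional_def)

lemma nat_comp_assoc:
  assumes "category D" "\<theta> \<in> Nat C D F G" "\<psi> \<in> Nat C D G K" "\<chi> \<in> Nat C D K L"
  shows "nat_comp C D (nat_comp C D \<chi> \<psi>) \<theta> = nat_comp C D \<chi> (nat_comp C D \<psi> \<theta>)"
  using category.Comp_assoc[OF assms(1) NatD(1)[OF assms(2)] NatD(1)[OF assms(3)] NatD(1)[OF assms(4)]]
  by (auto simp: nat_comp_def fun_eq_iff)

section \<open>Transposition across a two-variable adjunction\<close>

definition flat where
  "flat A B X a b g = Comp B (AMap (HF X) (Id A a, g)) (unit X (a, b))"

definition sharp where
  "sharp A C X a c h = Comp C (counit X (a, c)) (AMap (TF X) (Id A a, h))"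

text \<open>
  The same data read with \<open>B\<close> and \<open>C\<close> replaced by \<open>C\<^sup>o\<^sup>p\<close> and \<open>B\<^sup>o\<^sup>p\<close>. The category \<open>A\<close> is kept: the
  functor \<open>H : A\<^sup>o\<^sup>p \<times> C \<rightarrow> B\<close> is, on opposites, a functor \<open>A \<times> C\<^sup>o\<^sup>p \<rightarrow> B\<^sup>o\<^sup>p\<close>, as the variance of \<open>T\<close> demands.
\<close>

definition dual :: "('a, 'ma, 'b, 'mb, 'c, 'mc) adj2L \<Rightarrow> ('a, 'ma, 'c, 'mc, 'b, 'mb) adj2L" where
  "dual X = \<lparr>TF = HF X, HF = TF X, counit = unit X, unit = counit X\<rparr>"

lemma dual_simps [simp]:
  "TF (dual X) = HF X" "HF (dual X) = TF X" "counit (dual X) = unit X" "unit (dual X) = counit X"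
  "dual (dual X) = X"
  by (simp_all add: dual_def)

lemma flat_dual: "flat A (op_cat C) (dual X) a c h = sharp A C X a c h"
  and sharp_dual: "sharp A (op_cat B) (dual X) a b g = flat A B X a b g"
  by (simp_all add: flat_def sharp_def)

locale adjunction_2L = A: category A + B: category B + C: category C + left_sided_adjunction A B C X
  for A :: "('a, 'ma) cat" and B :: "('b, 'mb) cat" and C :: "('c, 'mc) cat"
    and X :: "('a, 'ma, 'b, 'mb, 'c, 'mc) adj2L"
begin

abbreviation "TO a b \<equiv> OMap (TF X) (a, b)"
abbreviation "HO a c \<equiv> OMap (HF X) (a, c)"
abbreviation "TA f k \<equiv> AMap (TF X) (f, k)"
abbreviation "HA f m \<equiv> AMap (HF X) (f, m)"

lemma TO_Obj: "a \<in> Obj A \<Longrightarrow> b \<in> Obj B \<Longrightarrow> TO a b \<in> Obj C"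
  using T.OMap_funcset by auto

lemma HO_Obj: "a \<in> Obj A \<Longrightarrow> c \<in> Obj C \<Longrightarrow> HO a c \<in> Obj B"
  using H.OMap_funcset by auto

lemma TA_hom: "f \<in> hom A a a' \<Longrightarrow> k \<in> hom B b b' \<Longrightarrow> TA f k \<in> hom C (TO a b) (TO a' b')"
  by (rule T.AMap_in_hom) simp

lemma HA_hom: "f \<in> hom A a a' \<Longrightarrow> m \<in> hom C c c' \<Longrightarrow> HA f m \<in> hom B (HO a' c) (HO a c')"
  by (rule H.AMap_in_hom) simp

lemma TA_Comp:
  "f \<in> hom A a a' \<Longrightarrow> f' \<in> hom A a' a'' \<Longrightarrow> k \<in> hom B b b' \<Longrightarrow> k' \<in> hom B b' b''
    \<Longrightarrow> TA (f' \<cdot>\<^bsub>A\<^esub> f) (k' \<cdot>\<^bsub>B\<^esub> k) = TA f' k' \<cdot>\<^bsub>C\<^esub> TA f k"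
  using T.AMap_Comp[of "(f, k)" "(a, b)" "(a', b')" "(f', k')" "(a'', b'')"] by simp

lemma HA_Comp:
  "f \<in> hom A a a' \<Longrightarrow> f' \<in> hom A a' a'' \<Longrightarrow> m \<in> hom C c c' \<Longrightarrow> m' \<in> hom C c' c''
    \<Longrightarrow> HA (f' \<cdot>\<^bsub>A\<^esub> f) (m' \<cdot>\<^bsub>C\<^esub> m) = HA f m' \<cdot>\<^bsub>B\<^esub> HA f' m"
  using H.AMap_Comp[of "(f', m)" "(a'', c)" "(a', c')" "(f, m')" "(a, c'')"] by simp

lemma TA_Comp_right:
  "a \<in> Obj A \<Longrightarrow> k \<in> hom B b b' \<Longrightarrow> k' \<in> hom B b' b''
    \<Longrightarrow> TA (Id A a) (k' \<cdot>\<^bsub>B\<^esub> k) = TA (Id A a) k' \<cdot>\<^bsub>C\<^esub> TA (Id A a) k"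
  using TA_Comp[of "Id A a" a a "Id A a" a] by (simp add: A.Id_in_hom A.Id_Comp[OF A.Id_in_hom])

lemma HA_Comp_right:
  "a \<in> Obj A \<Longrightarrow> m \<in> hom C c c' \<Longrightarrow> m' \<in> hom C c' c''
    \<Longrightarrow> HA (Id A a) (m' \<cdot>\<^bsub>C\<^esub> m) = HA (Id A a) m' \<cdot>\<^bsub>B\<^esub> HA (Id A a) m"
  using HA_Comp[of "Id A a" a a "Id A a" a] by (simp add: A.Id_in_hom A.Id_Comp[OF A.Id_in_hom])

text \<open>
  The axioms come in pairs that reversing the arrows of \<open>B\<close> and \<open>C\<close> exchanges: naturality and
  extranaturality of the counit with those of the unit, and one triangle identity with the other.
\<close>

lemma dual: "adjunction_2L A (op_cat C) (op_cat B) (dual X)"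
proof -
  have "cat_functor (prod_cat A (op_cat C)) (op_cat B) (HF X)"
    using H.op by (simp add: op_prod_cat)
  moreover have "cat_functor (prod_cat (op_cat A) (op_cat B)) (op_cat C) (TF X)"
    using T.op by (simp add: op_prod_cat)
  ultimately show ?thesis
    by (simp add: adjunction_2L_def left_sided_adjunction_def left_sided_adjunction_axioms_def
        A.category_axioms B.op C.op counit_extensional unit_extensional counit_in_hom unit_in_hom
        counit_natural unit_natural counit_extranatural unit_extranatural triangle_H triangle_T)
qed

lemma flat_hom:
  assumes "a \<in> Obj A" "b \<in> Obj B" "g \<in> hom C (TO a b) c"
  shows "flat A B X a b g \<in> hom B b (HO a c)"
  unfolding flat_def
  by (rule B.Comp_in_hom[OF unit_in_hom[OF assms(1,2)] HA_hom[OF A.Id_in_hom[OF assms(1)] assms(3)]])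

text \<open>
  Naturality of the transposition in \<open>b\<close>, which comes from naturality of the unit.
\<close>

lemma flat_Comp_right:
  assumes a: "a \<in> Obj A" and k: "k \<in> hom B b' b" and g: "g \<in> hom C (TO a b) c"
  shows "flat A B X a b' (g \<cdot>\<^bsub>C\<^esub> TA (Id A a) k) = flat A B X a b g \<cdot>\<^bsub>B\<^esub> k"
proof -
  have b: "b \<in> Obj B" "b' \<in> Obj B" using B.hom_Obj[OF k] by auto
  note i = A.Id_in_hom[OF a]
  have "flat A B X a b' (g \<cdot>\<^bsub>C\<^esub> TA (Id A a) k)
      = (HA (Id A a) g \<cdot>\<^bsub>B\<^esub> HA (Id A a) (TA (Id A a) k)) \<cdot>\<^bsub>B\<^esub> unit X (a, b')"
    by (simp add: flat_def HA_Comp_right[OF a TA_hom[OF i k] g])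
  also have "\<dots> = HA (Id A a) g \<cdot>\<^bsub>B\<^esub> (HA (Id A a) (TA (Id A a) k) \<cdot>\<^bsub>B\<^esub> unit X (a, b'))"
    by (rule B.Comp_assoc[OF unit_in_hom[OF a b(2)] HA_hom[OF i TA_hom[OF i k]] HA_hom[OF i g]])
  also have "\<dots> = HA (Id A a) g \<cdot>\<^bsub>B\<^esub> (unit X (a, b) \<cdot>\<^bsub>B\<^esub> k)"
    by (simp add: unit_natural[OF a k])
  also have "\<dots> = flat A B X a b g \<cdot>\<^bsub>B\<^esub> k"
    unfolding flat_def
    by (rule B.Comp_assoc[OF k unit_in_hom[OF a b(1)] HA_hom[OF i g], symmetric])
  finally show ?thesis .
qed

text \<open>
  Naturality in \<open>c\<close> and \<open>a\<close> together. The variable \<open>a\<close> occurs covariantly in \<open>T\<close> and contravariantly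
  in \<open>H\<close>, and extranaturality of the unit moves \<open>f\<close> from the one to the other.
\<close>

lemma flat_Comp_left:
  assumes f: "f \<in> hom A a' a" and b: "b \<in> Obj B" and g: "g \<in> hom C (TO a b) c"
    and m: "m \<in> hom C c c'"
  shows "flat A B X a' b ((m \<cdot>\<^bsub>C\<^esub> g) \<cdot>\<^bsub>C\<^esub> TA f (Id B b)) = HA f m \<cdot>\<^bsub>B\<^esub> flat A B X a b g"
proof -
  have a: "a \<in> Obj A" "a' \<in> Obj A" using A.hom_Obj[OF f] by auto
  note i = A.Id_in_hom[OF a(1)] and i' = A.Id_in_hom[OF a(2)]
  note t = TA_hom[OF f B.Id_in_hom[OF b]] and mg = C.Comp_in_hom[OF g m]
  note 1 = C.Id_in_hom[OF TO_Obj[OF a(1) b]]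
  have "flat A B X a' b ((m \<cdot>\<^bsub>C\<^esub> g) \<cdot>\<^bsub>C\<^esub> TA f (Id B b))
      = (HA (Id A a') (m \<cdot>\<^bsub>C\<^esub> g) \<cdot>\<^bsub>B\<^esub> HA (Id A a') (TA f (Id B b))) \<cdot>\<^bsub>B\<^esub> unit X (a', b)"
    by (simp add: flat_def HA_Comp_right[OF a(2) t mg])
  also have "\<dots> = HA (Id A a') (m \<cdot>\<^bsub>C\<^esub> g) \<cdot>\<^bsub>B\<^esub> (HA (Id A a') (TA f (Id B b)) \<cdot>\<^bsub>B\<^esub> unit X (a', b))"
    by (rule B.Comp_assoc[OF unit_in_hom[OF a(2) b] HA_hom[OF i' t] HA_hom[OF i' mg]])
  also have "\<dots> = HA (Id A a') (m \<cdot>\<^bsub>C\<^esub> g) \<cdot>\<^bsub>B\<^esub> (HA f (Id C (TO a b)) \<cdot>\<^bsub>B\<^esub> unit X (a, b))"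
    by (simp add: unit_extranatural[OF f b])
  also have "\<dots> = (HA (Id A a') (m \<cdot>\<^bsub>C\<^esub> g) \<cdot>\<^bsub>B\<^esub> HA f (Id C (TO a b))) \<cdot>\<^bsub>B\<^esub> unit X (a, b)"
    by (rule B.Comp_assoc[OF unit_in_hom[OF a(1) b] HA_hom[OF f 1] HA_hom[OF i' mg], symmetric])
  \<comment> \<open>Both composites are \<open>H(f, m g)\<close>: by bifunctoriality the two variables can be exchanged.\<close>
  also have "HA (Id A a') (m \<cdot>\<^bsub>C\<^esub> g) \<cdot>\<^bsub>B\<^esub> HA f (Id C (TO a b)) = HA f m \<cdot>\<^bsub>B\<^esub> HA (Id A a) g"
    using HA_Comp[OF i' f 1 mg] HA_Comp[OF f i g m] A.Comp_Id[OF f] A.Id_Comp[OF f] C.Comp_Id[OF mg]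
    by simp
  also have "(HA f m \<cdot>\<^bsub>B\<^esub> HA (Id A a) g) \<cdot>\<^bsub>B\<^esub> unit X (a, b) = HA f m \<cdot>\<^bsub>B\<^esub> flat A B X a b g"
    unfolding flat_def
    by (rule B.Comp_assoc[OF unit_in_hom[OF a(1) b] HA_hom[OF i g] HA_hom[OF f m]])
  finally show ?thesis .
qed

text \<open>
  By naturality of the counit and the triangle identity at \<open>T\<close>. The other round trip, \<open>flat_sharp\<close>,
  is this statement for the dual adjunction.
\<close>

lemma sharp_flat:
  assumes a: "a \<in> Obj A" and b: "b \<in> Obj B" and g: "g \<in> hom C (TO a b) c"
  shows "sharp A C X a c (flat A B X a b g) = g"
proof -
  have c: "c \<in> Obj C" using C.hom_Obj[OF g] by auto
  note i = A.Id_in_hom[OF a] and u = unit_in_hom[OF a b]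
  note h = HA_hom[OF i g]
  have "sharp A C X a c (flat A B X a b g)
      = counit X (a, c) \<cdot>\<^bsub>C\<^esub> (TA (Id A a) (HA (Id A a) g) \<cdot>\<^bsub>C\<^esub> TA (Id A a) (unit X (a, b)))"
    by (simp add: sharp_def flat_def TA_Comp_right[OF a u h])
  also have "\<dots> = (counit X (a, c) \<cdot>\<^bsub>C\<^esub> TA (Id A a) (HA (Id A a) g)) \<cdot>\<^bsub>C\<^esub> TA (Id A a) (unit X (a, b))"
    by (rule C.Comp_assoc[OF TA_hom[OF i u] TA_hom[OF i h] counit_in_hom[OF a c], symmetric])
  also have "\<dots> = (g \<cdot>\<^bsub>C\<^esub> counit X (a, TO a b)) \<cdot>\<^bsub>C\<^esub> TA (Id A a) (unit X (a, b))"
    by (simp add: counit_natural[OF a g])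
  also have "\<dots> = g \<cdot>\<^bsub>C\<^esub> (counit X (a, TO a b) \<cdot>\<^bsub>C\<^esub> TA (Id A a) (unit X (a, b)))"
    by (rule C.Comp_assoc[OF TA_hom[OF i u] counit_in_hom[OF a TO_Obj[OF a b]] g])
  also have "\<dots> = g"
    by (simp add: triangle_T[OF a b] C.Comp_Id[OF g])
  finally show ?thesis .
qed

lemma sharp_hom:
  assumes "a \<in> Obj A" "c \<in> Obj C" "h \<in> hom B b (HO a c)"
  shows "sharp A C X a c h \<in> hom C (TO a b) c"
  using adjunction_2L.flat_hom[OF dual, of a c h b] assms by (simp add: flat_dual)

lemma flat_sharp:
  assumes "a \<in> Obj A" "c \<in> Obj C" "h \<in> hom B b (HO a c)"
  shows "flat A B X a b (sharp A C X a c h) = h"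
  using adjunction_2L.sharp_flat[OF dual, of a c h b] assms by (simp add: flat_dual sharp_dual)

lemma flat_counit:
  assumes "a \<in> Obj A" "c \<in> Obj C"
  shows "flat A B X a (HO a c) (counit X (a, c)) = Id B (HO a c)"
  by (simp add: flat_def triangle_H[OF assms])

end

section \<open>Conjugate pairs\<close>

text \<open>
  The transposed action of \<open>\<theta>\<close> by precomposition is postcomposition with \<open>\<phi>\<close>. Quantifying over all
  arrows \<open>g\<close>, not only over the counits of \<open>Y\<close>, makes this relation composable and self-dual.
\<close>

definition conjugate where
  "conjugate A B C X Y \<theta> \<phi> \<longleftrightarrow>
    (\<forall>a\<in>Obj A. \<forall>b\<in>Obj B. \<forall>c. \<forall>g\<in>hom C (OMap (TF Y) (a, b)) c.
      Comp B (\<phi> (a, c)) (flat A B Y a b g) = flat A B X a b (Comp C g (\<theta> (a, b))))"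

lemma Nat_T_dual: "Nat_T A (op_cat C) (op_cat B) (dual X) (dual Y) = Nat_H A B C X Y"
  and Nat_H_dual: "Nat_H A (op_cat C) (op_cat B) (dual X) (dual Y) = Nat_T A B C X Y"
proof -
  have "prod_cat A (op_cat C) = op_cat (prod_cat (op_cat A) C)"
    by (simp add: op_prod_cat)
  then show "Nat_T A (op_cat C) (op_cat B) (dual X) (dual Y) = Nat_H A B C X Y"
    by (simp add: Nat_T_def Nat_H_def Nat_op)
  show "Nat_H A (op_cat C) (op_cat B) (dual X) (dual Y) = Nat_T A B C X Y"
    by (simp add: Nat_T_def Nat_H_def op_prod_cat[symmetric] Nat_op)
qed

lemma Nat_T_hom:
  "\<theta> \<in> Nat_T A B C X Y \<Longrightarrow> a \<in> Obj A \<Longrightarrow> b \<in> Obj B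
    \<Longrightarrow> \<theta> (a, b) \<in> hom C (OMap (TF X) (a, b)) (OMap (TF Y) (a, b))"
  by (auto simp: Nat_T_def intro: NatD(1))

lemma Nat_H_hom:
  "\<phi> \<in> Nat_H A B C X Y \<Longrightarrow> a \<in> Obj A \<Longrightarrow> c \<in> Obj C
    \<Longrightarrow> \<phi> (a, c) \<in> hom B (OMap (HF Y) (a, c)) (OMap (HF X) (a, c))"
  by (auto simp: Nat_H_def intro: NatD(1))

locale adjunction_2L_pair = X: adjunction_2L A B C X + Y: adjunction_2L A B C Y
  for A :: "('a, 'ma) cat" and B :: "('b, 'mb) cat" and C :: "('c, 'mc) cat"
    and X Y :: "('a, 'ma, 'b, 'mb, 'c, 'mc) adj2L"
begin

lemma dual: "adjunction_2L_pair A (op_cat C) (op_cat B) (dual X) (dual Y)"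
  by (intro adjunction_2L_pair.intro X.dual Y.dual)

text \<open>
  The composite that defines conjugation is a single transpose, so the laws for \<open>flat\<close> apply to it.
\<close>

lemma conj_l_flat:
  assumes th: "\<theta> \<in> Nat_T A B C X Y" and a: "a \<in> Obj A" and c: "c \<in> Obj C"
  shows "conj_l A B C X Y \<theta> (a, c)
    = flat A B X a (Y.HO a c) (counit Y (a, c) \<cdot>\<^bsub>C\<^esub> \<theta> (a, Y.HO a c))"
proof -
  note i = X.A.Id_in_hom[OF a] and b = Y.HO_Obj[OF a c] and e = Y.counit_in_hom[OF a c]
  note t = Nat_T_hom[OF th a b]
  show ?thesis
    using a c X.B.Comp_assoc[OF X.unit_in_hom[OF a b] X.HA_hom[OF i t] X.HA_hom[OF i e]]
    by (simp add: conj_l_def flat_def X.HA_Comp_right[OF a t e])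
qed

text \<open>
  The Yoneda step. The component of the conjugate is defined at the counit; precomposing with the
  transpose \<open>h\<close> of \<open>g\<close> and moving \<open>h\<close> past \<open>\<theta>\<close> by naturality reassembles \<open>g\<close> from the counit.
\<close>

lemma conj_l_flat_Comp:
  assumes th: "\<theta> \<in> Nat_T A B C X Y" and a: "a \<in> Obj A" and b: "b \<in> Obj B"
    and g: "g \<in> hom C (Y.TO a b) c"
  shows "conj_l A B C X Y \<theta> (a, c) \<cdot>\<^bsub>B\<^esub> flat A B Y a b g
    = flat A B X a b (g \<cdot>\<^bsub>C\<^esub> \<theta> (a, b))"
proof -
  define h where "h = flat A B Y a b g"
  have c: "c \<in> Obj C" using X.C.hom_Obj[OF g] by auto
  note i = X.A.Id_in_hom[OF a] and b' = Y.HO_Obj[OF a c] and e = Y.counit_in_hom[OF a c]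
  have h: "h \<in> hom B b (Y.HO a c)" unfolding h_def by (rule Y.flat_hom[OF a b g])
  note t = Nat_T_hom[OF th a b] and t' = Nat_T_hom[OF th a b']
  have "conj_l A B C X Y \<theta> (a, c) \<cdot>\<^bsub>B\<^esub> h
      = flat A B X a b ((counit Y (a, c) \<cdot>\<^bsub>C\<^esub> \<theta> (a, Y.HO a c)) \<cdot>\<^bsub>C\<^esub> X.TA (Id A a) h)"
    by (simp add: conj_l_flat[OF th a c] X.flat_Comp_right[OF a h X.C.Comp_in_hom[OF t' e]])
  also have "(counit Y (a, c) \<cdot>\<^bsub>C\<^esub> \<theta> (a, Y.HO a c)) \<cdot>\<^bsub>C\<^esub> X.TA (Id A a) h
      = counit Y (a, c) \<cdot>\<^bsub>C\<^esub> (\<theta> (a, Y.HO a c) \<cdot>\<^bsub>C\<^esub> X.TA (Id A a) h)"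
    by (rule X.C.Comp_assoc[OF X.TA_hom[OF i h] t' e])
  also have "\<theta> (a, Y.HO a c) \<cdot>\<^bsub>C\<^esub> X.TA (Id A a) h = Y.TA (Id A a) h \<cdot>\<^bsub>C\<^esub> \<theta> (a, b)"
    using th unfolding Nat_T_def by (rule NatD(2)) (simp_all add: X.T.source.category_axioms i h)
  also have "counit Y (a, c) \<cdot>\<^bsub>C\<^esub> (Y.TA (Id A a) h \<cdot>\<^bsub>C\<^esub> \<theta> (a, b)) = sharp A C Y a c h \<cdot>\<^bsub>C\<^esub> \<theta> (a, b)"
    unfolding sharp_def by (rule X.C.Comp_assoc[OF t Y.TA_hom[OF i h] e, symmetric])
  also have "sharp A C Y a c h = g"
    unfolding h_def by (rule Y.sharp_flat[OF a b g])
  finally show ?thesis unfolding h_def .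
qed

lemma conjugate_conj_l: "\<theta> \<in> Nat_T A B C X Y \<Longrightarrow> conjugate A B C X Y \<theta> (conj_l A B C X Y \<theta>)"
  by (simp add: conjugate_def conj_l_flat_Comp)

text \<open>
  Naturality of the conjugate in both variables at once: an arrow \<open>H'(f, m)\<close> is itself the transpose
  of \<open>m \<epsilon>' T'(f, 1)\<close>, so applying the conjugate to it is precomposing this arrow with \<open>\<theta>\<close>, where
  naturality of \<open>\<theta>\<close> lets \<open>T'(f, 1)\<close> pass.
\<close>

lemma conj_l_in_Nat_H:
  assumes th: "\<theta> \<in> Nat_T A B C X Y"
  shows "conj_l A B C X Y \<theta> \<in> Nat_H A B C X Y"
proof -
  let ?\<phi> = "conj_l A B C X Y \<theta>"
  have hom: "?\<phi> (a, c) \<in> hom B (Y.HO a c) (X.HO a c)" if a: "a \<in> Obj A" and c: "c \<in> Obj C" for a c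
    unfolding conj_l_flat[OF th a c]
    by (rule X.flat_hom[OF a Y.HO_Obj[OF a c]
          X.C.Comp_in_hom[OF Nat_T_hom[OF th a Y.HO_Obj[OF a c]] Y.counit_in_hom[OF a c]]])
  have nat: "?\<phi> (a', c') \<cdot>\<^bsub>B\<^esub> Y.HA f m = X.HA f m \<cdot>\<^bsub>B\<^esub> ?\<phi> (a, c)"
    if f: "f \<in> hom A a' a" and m: "m \<in> hom C c c'" for f m a a' c c'
  proof -
    have a: "a \<in> Obj A" "a' \<in> Obj A" and c: "c \<in> Obj C" "c' \<in> Obj C"
      using X.A.hom_Obj[OF f] X.C.hom_Obj[OF m] by auto
    let ?b = "Y.HO a c" and ?e = "counit Y (a, c)"
    note b = Y.HO_Obj[OF a(1) c(1)] and e = Y.counit_in_hom[OF a(1) c(1)]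
    note 1 = X.B.Id_in_hom[OF b] and me = X.C.Comp_in_hom[OF e m]
    note t = Nat_T_hom[OF th a(1) b] and t' = Nat_T_hom[OF th a(2) b]
    have tf: "\<theta> (a, ?b) \<cdot>\<^bsub>C\<^esub> X.TA f (Id B ?b) = Y.TA f (Id B ?b) \<cdot>\<^bsub>C\<^esub> \<theta> (a', ?b)"
      using th unfolding Nat_T_def by (rule NatD(2)) (simp_all add: X.T.source.category_axioms f 1)
    have "Y.HA f m = Y.HA f m \<cdot>\<^bsub>B\<^esub> flat A B Y a ?b ?e"
      by (simp add: Y.flat_counit[OF a(1) c(1)] X.B.Comp_Id[OF Y.HA_hom[OF f m]])
    also have "\<dots> = flat A B Y a' ?b ((m \<cdot>\<^bsub>C\<^esub> ?e) \<cdot>\<^bsub>C\<^esub> Y.TA f (Id B ?b))"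
      by (rule Y.flat_Comp_left[OF f b e m, symmetric])
    finally have "?\<phi> (a', c') \<cdot>\<^bsub>B\<^esub> Y.HA f m
        = flat A B X a' ?b (((m \<cdot>\<^bsub>C\<^esub> ?e) \<cdot>\<^bsub>C\<^esub> Y.TA f (Id B ?b)) \<cdot>\<^bsub>C\<^esub> \<theta> (a', ?b))"
      using conj_l_flat_Comp[OF th a(2) b X.C.Comp_in_hom[OF Y.TA_hom[OF f 1] me]] by simp
    also have "((m \<cdot>\<^bsub>C\<^esub> ?e) \<cdot>\<^bsub>C\<^esub> Y.TA f (Id B ?b)) \<cdot>\<^bsub>C\<^esub> \<theta> (a', ?b)
        = (m \<cdot>\<^bsub>C\<^esub> (?e \<cdot>\<^bsub>C\<^esub> \<theta> (a, ?b))) \<cdot>\<^bsub>C\<^esub> X.TA f (Id B ?b)"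
      using X.C.Comp_assoc[OF t' Y.TA_hom[OF f 1] me] X.C.Comp_assoc[OF X.TA_hom[OF f 1] t me]
        X.C.Comp_assoc[OF t e m] tf by simp
    also have "flat A B X a' ?b \<dots> = X.HA f m \<cdot>\<^bsub>B\<^esub> ?\<phi> (a, c)"
      by (simp add: conj_l_flat[OF th a(1) c(1)]
          X.flat_Comp_left[OF f b X.C.Comp_in_hom[OF t e] m])
    finally show ?thesis .
  qed
  have "?\<phi> \<in> extensional (Obj A \<times> Obj C)"
    by (simp add: conj_l_def)
  then show ?thesis
    using hom nat by (auto simp: Nat_H_def Nat_def)
qed

text \<open>
  A conjugate of \<open>\<theta>\<close> is determined by its value at \<open>g = \<epsilon>'\<close>, whose transpose is an identity.
\<close>

lemma conjugate_unique:
  assumes th: "\<theta> \<in> Nat_T A B C X Y" and ph: "\<phi> \<in> Nat_H A B C X Y"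
    and conj: "conjugate A B C X Y \<theta> \<phi>"
  shows "\<phi> = conj_l A B C X Y \<theta>"
proof (rule extensionalityI)
  show "\<phi> \<in> extensional (Obj A \<times> Obj C)"
    using NatD(3)[OF ph[unfolded Nat_H_def]] by simp
  show "conj_l A B C X Y \<theta> \<in> extensional (Obj A \<times> Obj C)"
    by (simp add: conj_l_def)
  fix p assume "p \<in> Obj A \<times> Obj C"
  then obtain a c where p: "p = (a, c)" and a: "a \<in> Obj A" and c: "c \<in> Obj C" by auto
  have "\<phi> (a, c) = \<phi> (a, c) \<cdot>\<^bsub>B\<^esub> flat A B Y a (Y.HO a c) (counit Y (a, c))"
    by (simp add: Y.flat_counit[OF a c] X.B.Comp_Id[OF Nat_H_hom[OF ph a c]])
  also have "\<dots> = conj_l A B C X Y \<theta> (a, c)"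
    using conj Y.HO_Obj[OF a c] Y.counit_in_hom[OF a c] a
    by (simp add: conjugate_def conj_l_flat[OF th a c])
  finally show "\<phi> p = conj_l A B C X Y \<theta> p" by (simp add: p)
qed

text \<open>
  Transposing both sides of the defining equation at \<open>g = sharp h\<close> turns it into the defining
  equation for the dual adjunctions, since \<open>flat\<close> and \<open>sharp\<close> are mutually inverse.
\<close>

lemma conjugate_dual:
  assumes th: "\<theta> \<in> Nat_T A B C X Y" and conj: "conjugate A B C X Y \<theta> \<phi>"
  shows "conjugate A (op_cat C) (op_cat B) (dual X) (dual Y) \<phi> \<theta>"
proof -
  have "sharp A C Y a c h \<cdot>\<^bsub>C\<^esub> \<theta> (a, b) = sharp A C X a c (\<phi> (a, c) \<cdot>\<^bsub>B\<^esub> h)"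
    if a: "a \<in> Obj A" and c: "c \<in> Obj C" and h: "h \<in> hom B b (Y.HO a c)" for a b c h
  proof -
    have b: "b \<in> Obj B" using X.B.hom_Obj[OF h] by auto
    note g = Y.sharp_hom[OF a c h]
    have "\<phi> (a, c) \<cdot>\<^bsub>B\<^esub> h = flat A B X a b (sharp A C Y a c h \<cdot>\<^bsub>C\<^esub> \<theta> (a, b))"
      using conj a b g by (metis conjugate_def Y.flat_sharp[OF a c h])
    then show ?thesis
      by (simp add: X.sharp_flat[OF a b X.C.Comp_in_hom[OF Nat_T_hom[OF th a b] g]])
  qed
  then show ?thesis
    by (simp add: conjugate_def flat_dual)
qed

text \<open>
  Both sides are the same composite of three arrows; reversing their order moves the parentheses.
\<close>

lemma conj_r_dual:
  assumes ph: "\<phi> \<in> Nat_H A B C X Y"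
  shows "conj_r A B C X Y \<phi> = conj_l A (op_cat C) (op_cat B) (dual X) (dual Y) \<phi>"
proof -
  have "counit X (a, Y.TO a b) \<cdot>\<^bsub>C\<^esub> X.TA (Id A a) (\<phi> (a, Y.TO a b)) \<cdot>\<^bsub>C\<^esub> X.TA (Id A a) (unit Y (a, b))
      = (counit X (a, Y.TO a b) \<cdot>\<^bsub>C\<^esub> X.TA (Id A a) (\<phi> (a, Y.TO a b))) \<cdot>\<^bsub>C\<^esub> X.TA (Id A a) (unit Y (a, b))"
    if a: "a \<in> Obj A" and b: "b \<in> Obj B" for a b
  proof -
    note i = X.A.Id_in_hom[OF a] and c = Y.TO_Obj[OF a b]
    show ?thesis
      by (rule X.C.Comp_assoc[OF X.TA_hom[OF i Y.unit_in_hom[OF a b]]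
            X.TA_hom[OF i Nat_H_hom[OF ph a c]] X.counit_in_hom[OF a c], symmetric])
  qed
  then show ?thesis
    by (auto simp: conj_r_def conj_l_def fun_eq_iff restrict_def)
qed

lemma conj_r_in_Nat_T: "\<phi> \<in> Nat_H A B C X Y \<Longrightarrow> conj_r A B C X Y \<phi> \<in> Nat_T A B C X Y"
  using adjunction_2L_pair.conj_l_in_Nat_H[OF dual, of \<phi>]
  by (simp add: conj_r_dual Nat_T_dual Nat_H_dual)

text \<open>
  By duality, \<open>\<theta>\<close> is a conjugate of its conjugate, and conjugates are unique.
\<close>

lemma conj_r_conj_l:
  assumes th: "\<theta> \<in> Nat_T A B C X Y"
  shows "conj_r A B C X Y (conj_l A B C X Y \<theta>) = \<theta>"
  using adjunction_2L_pair.conjugate_unique[OF dual, of "conj_l A B C X Y \<theta>" \<theta>]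
    conjugate_dual[OF th conjugate_conj_l[OF th]] conj_l_in_Nat_H[OF th] th
  by (simp add: conj_r_dual Nat_T_dual Nat_H_dual)

lemma conj_l_conj_r:
  assumes ph: "\<phi> \<in> Nat_H A B C X Y"
  shows "conj_l A B C X Y (conj_r A B C X Y \<phi>) = \<phi>"
proof -
  interpret D: adjunction_2L_pair A "op_cat C" "op_cat B" "dual X" "dual Y" by (rule dual)
  have "conj_r A (op_cat C) (op_cat B) (dual X) (dual Y) (conj_r A B C X Y \<phi>)
      = conj_l A B C X Y (conj_r A B C X Y \<phi>)"
    using D.conj_r_dual conj_r_in_Nat_T[OF ph] by (simp add: Nat_H_dual)
  then show ?thesis
    using D.conj_r_conj_l[of \<phi>] ph by (simp add: conj_r_dual Nat_T_dual)
qed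

end

text \<open>
  Preservation of identities and of composition follows from uniqueness of conjugates: for the
  identities both sides of the defining equation are \<open>flat g\<close>, and for a composite the equations of
  the two factors are applied in succession.
\<close>

lemma (in adjunction_2L) conj_l_id:
  "conj_l A B C X X (nat_id (prod_cat A B) C (TF X)) = nat_id (prod_cat (op_cat A) C) B (HF X)"
proof -
  interpret adjunction_2L_pair A B C X X by unfold_locales
  have "conjugate A B C X X (nat_id (prod_cat A B) C (TF X)) (nat_id (prod_cat (op_cat A) C) B (HF X))"
    using C.hom_Obj
    by (auto simp: conjugate_def nat_id_def B.Id_Comp[OF flat_hom] C.Comp_Id)
  moreover have "nat_id (prod_cat A B) C (TF X) \<in> Nat_T A B C X X"
    unfolding Nat_T_def by (rule nat_id_in_Nat[OF T.cat_functor_axioms])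
  moreover have "nat_id (prod_cat (op_cat A) C) B (HF X) \<in> Nat_H A B C X X"
    unfolding Nat_H_def by (rule nat_id_in_Nat[OF H.cat_functor_axioms])
  ultimately show ?thesis
    by (metis conjugate_unique)
qed

lemma nat_comp_in_Nat_T:
  assumes "left_sided_adjunction A B C X" "left_sided_adjunction A B C Y" "left_sided_adjunction A B C Z"
    and "\<theta> \<in> Nat_T A B C X Y" "\<psi> \<in> Nat_T A B C Y Z"
  shows "nat_comp (prod_cat A B) C \<psi> \<theta> \<in> Nat_T A B C X Z"
  using assms nat_comp_in_Nat[of "prod_cat A B" C \<theta> "TF X" "TF Y" \<psi> "TF Z"]
  by (auto simp: Nat_T_def left_sided_adjunction_def cat_functor_def)

lemma nat_comp_in_Nat_H:
  assumes "left_sided_adjunction A B C X" "left_sided_adjunction A B C Y" "left_sided_adjunction A B C Z"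
    and "\<phi> \<in> Nat_H A B C X Y" "\<psi> \<in> Nat_H A B C Y Z"
  shows "nat_comp (prod_cat (op_cat A) C) B \<phi> \<psi> \<in> Nat_H A B C X Z"
  using assms nat_comp_in_Nat[of "prod_cat (op_cat A) C" B \<psi> "HF Z" "HF Y" \<phi> "HF X"]
  by (auto simp: Nat_H_def left_sided_adjunction_def cat_functor_def)

lemma conj_l_comp:
  assumes X: "adjunction_2L A B C X" and Y: "adjunction_2L A B C Y" and Z: "adjunction_2L A B C Z"
    and th: "\<theta> \<in> Nat_T A B C X Y" and ps: "\<psi> \<in> Nat_T A B C Y Z"
  shows "conj_l A B C X Z (nat_comp (prod_cat A B) C \<psi> \<theta>)
    = nat_comp (prod_cat (op_cat A) C) B (conj_l A B C X Y \<theta>) (conj_l A B C Y Z \<psi>)"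
proof -
  interpret XY: adjunction_2L_pair A B C X Y by (intro adjunction_2L_pair.intro X Y)
  interpret YZ: adjunction_2L_pair A B C Y Z by (intro adjunction_2L_pair.intro Y Z)
  interpret XZ: adjunction_2L_pair A B C X Z by (intro adjunction_2L_pair.intro X Z)
  let ?\<phi> = "conj_l A B C X Y \<theta>" and ?\<chi> = "conj_l A B C Y Z \<psi>"
  note adj = XY.X.left_sided_adjunction_axioms XY.Y.left_sided_adjunction_axioms
    YZ.Y.left_sided_adjunction_axioms
  note ph = XY.conj_l_in_Nat_H[OF th] and ch = YZ.conj_l_in_Nat_H[OF ps]
  have "(?\<phi> (a, c) \<cdot>\<^bsub>B\<^esub> ?\<chi> (a, c)) \<cdot>\<^bsub>B\<^esub> flat A B Z a b g
      = flat A B X a b (g \<cdot>\<^bsub>C\<^esub> (\<psi> (a, b) \<cdot>\<^bsub>C\<^esub> \<theta> (a, b)))"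
    if a: "a \<in> Obj A" and b: "b \<in> Obj B" and g: "g \<in> hom C (OMap (TF Z) (a, b)) c" for a b c g
  proof -
    have c: "c \<in> Obj C" using XY.X.C.hom_Obj[OF g] by auto
    note t = Nat_T_hom[OF th a b] and p = Nat_T_hom[OF ps a b]
    have "(?\<phi> (a, c) \<cdot>\<^bsub>B\<^esub> ?\<chi> (a, c)) \<cdot>\<^bsub>B\<^esub> flat A B Z a b g
        = ?\<phi> (a, c) \<cdot>\<^bsub>B\<^esub> (?\<chi> (a, c) \<cdot>\<^bsub>B\<^esub> flat A B Z a b g)"
      by (rule XY.X.B.Comp_assoc[OF YZ.Y.flat_hom[OF a b g] Nat_H_hom[OF ch a c] Nat_H_hom[OF ph a c]])
    also have "\<dots> = ?\<phi> (a, c) \<cdot>\<^bsub>B\<^esub> flat A B Y a b (g \<cdot>\<^bsub>C\<^esub> \<psi> (a, b))"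
      by (simp add: YZ.conj_l_flat_Comp[OF ps a b g])
    also have "\<dots> = flat A B X a b ((g \<cdot>\<^bsub>C\<^esub> \<psi> (a, b)) \<cdot>\<^bsub>C\<^esub> \<theta> (a, b))"
      by (rule XY.conj_l_flat_Comp[OF th a b XY.X.C.Comp_in_hom[OF p g]])
    also have "(g \<cdot>\<^bsub>C\<^esub> \<psi> (a, b)) \<cdot>\<^bsub>C\<^esub> \<theta> (a, b) = g \<cdot>\<^bsub>C\<^esub> (\<psi> (a, b) \<cdot>\<^bsub>C\<^esub> \<theta> (a, b))"
      by (rule XY.X.C.Comp_assoc[OF t p g])
    finally show ?thesis .
  qed
  then have "conjugate A B C X Z (nat_comp (prod_cat A B) C \<psi> \<theta>)
      (nat_comp (prod_cat (op_cat A) C) B ?\<phi> ?\<chi>)"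
    using XY.X.C.hom_Obj by (auto simp: conjugate_def nat_comp_def)
  then show ?thesis
    using XZ.conjugate_unique nat_comp_in_Nat_T[OF adj th ps] nat_comp_in_Nat_H[OF adj ph ch] by metis
qed

section \<open>The isomorphism of categories\<close>

text \<open>
  The category structure common to both categories of adjunctions, where \<open>N\<close> gives the untagged
  hom-sets, \<open>e\<close> the identities and \<open>m\<close> the composition. The functor laws then reduce to
  statements about the untagged transformations.
\<close>

definition tagged_cat :: "'o set \<Rightarrow> ('o \<Rightarrow> 'o \<Rightarrow> 't set) \<Rightarrow> ('o \<Rightarrow> 't) \<Rightarrow> ('t \<Rightarrow> 't \<Rightarrow> 't)
    \<Rightarrow> ('o, ('o, 't) tagged) cat" where
  "tagged_cat S N e m = \<lparr>
    Obj = S,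
    Arr = {(X, t, Y). X \<in> S \<and> Y \<in> S \<and> t \<in> N X Y},
    Dom = (\<lambda>(X, t, Y). X),
    Cod = (\<lambda>(X, t, Y). Y),
    Id = (\<lambda>X. (X, e X, X)),
    Comp = (\<lambda>(Y', s, Z) (X, t, Y). (X, m s t, Z))\<rparr>"

lemma tagged_cat_simps [simp]:
  "Obj (tagged_cat S N e m) = S"
  "(X, t, Y) \<in> Arr (tagged_cat S N e m) \<longleftrightarrow> X \<in> S \<and> Y \<in> S \<and> t \<in> N X Y"
  "Dom (tagged_cat S N e m) (X, t, Y) = X"
  "Cod (tagged_cat S N e m) (X, t, Y) = Y"
  "Id (tagged_cat S N e m) X = (X, e X, X)"
  "Comp (tagged_cat S N e m) (Y', s, Z) (X, t, Y) = (X, m s t, Z)"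
  by (simp_all add: tagged_cat_def)

lemma hom_tagged_cat:
  "u \<in> hom (tagged_cat S N e m) X Y \<longleftrightarrow> (\<exists>t. u = (X, t, Y) \<and> X \<in> S \<and> Y \<in> S \<and> t \<in> N X Y)"
  by (auto simp: hom_def tagged_cat_def)

lemma category_tagged_cat:
  assumes "\<And>X. X \<in> S \<Longrightarrow> e X \<in> N X X"
    and "\<And>X Y Z s t. \<lbrakk>X \<in> S; Y \<in> S; Z \<in> S; t \<in> N X Y; s \<in> N Y Z\<rbrakk> \<Longrightarrow> m s t \<in> N X Z"
    and "\<And>X Y t. \<lbrakk>X \<in> S; Y \<in> S; t \<in> N X Y\<rbrakk> \<Longrightarrow> m t (e X) = t \<and> m (e Y) t = t"
    and "\<And>W X Y Z r s t. \<lbrakk>W \<in> S; X \<in> S; Y \<in> S; Z \<in> S; t \<in> N W X; s \<in> N X Y; r \<in> N Y Z\<rbrakk>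
      \<Longrightarrow> m (m r s) t = m r (m s t)"
  shows "category (tagged_cat S N e m)"
proof unfold_locales
  let ?C = "tagged_cat S N e m"
  fix f g h X Y Z W
  show "Dom ?C f \<in> Obj ?C" "Cod ?C f \<in> Obj ?C" if "f \<in> Arr ?C"
    using that by (cases f; simp)+
  show "Id ?C X \<in> hom ?C X X" if "X \<in> Obj ?C"
    using that assms(1) by (simp add: hom_tagged_cat)
  assume f: "f \<in> hom ?C X Y"
  then obtain t where t: "f = (X, t, Y)" "X \<in> S" "Y \<in> S" "t \<in> N X Y"
    by (auto simp: hom_tagged_cat)
  show "Comp ?C f (Id ?C X) = f" "Comp ?C (Id ?C Y) f = f"
    using t assms(3) by simp_all
  assume g: "g \<in> hom ?C Y Z"
  then obtain s where s: "g = (Y, s, Z)" "Z \<in> S" "s \<in> N Y Z"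
    by (auto simp: hom_tagged_cat)
  show "Comp ?C g f \<in> hom ?C X Z"
    using t s assms(2) by (simp add: hom_tagged_cat)
  assume h: "h \<in> hom ?C Z W"
  then obtain r where r: "h = (Z, r, W)" "W \<in> S" "r \<in> N Z W"
    by (auto simp: hom_tagged_cat)
  show "Comp ?C (Comp ?C h g) f = Comp ?C h (Comp ?C g f)"
    using t s r assms(4) by simp
qed

lemma functor_tagged_cat:
  assumes cats: "category (tagged_cat S N e m)" "category (tagged_cat S N' e' m')"
    and j: "\<And>X Y t. \<lbrakk>X \<in> S; Y \<in> S; t \<in> N X Y\<rbrakk> \<Longrightarrow> j X Y t \<in> N' X Y"
    and j_id: "\<And>X. X \<in> S \<Longrightarrow> j X X (e X) = e' X"
    and j_comp: "\<And>X Y Z s t. \<lbrakk>X \<in> S; Y \<in> S; Z \<in> S; t \<in> N X Y; s \<in> N Y Z\<rbrakk>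
      \<Longrightarrow> j X Z (m s t) = m' (j Y Z s) (j X Y t)"
  shows "cat_functor (tagged_cat S N e m) (tagged_cat S N' e' m')
    \<lparr>OMap = (\<lambda>X\<in>S. X), AMap = (\<lambda>(X, t, Y) \<in> Arr (tagged_cat S N e m). (X, j X Y t, Y))\<rparr>"
    (is "cat_functor ?C ?D ?F")
proof (intro cat_functor.intro cats cat_functor_axioms.intro)
  interpret C: category ?C by fact
  have AMap: "AMap ?F (X, t, Y) = (X, j X Y t, Y)" if "(X, t, Y) \<in> hom ?C X Y" for X Y t
    using that by (simp add: hom_tagged_cat)
  show "OMap ?F \<in> Obj ?C \<rightarrow>\<^sub>E Obj ?D" "AMap ?F \<in> extensional (Arr ?C)"
    by simp_all
  fix f g X Y Z
  show "AMap ?F (Id ?C X) = Id ?D (OMap ?F X)" if "X \<in> Obj ?C"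
    using AMap[of X "e X" X] C.Id_in_hom[OF that] that j_id by simp
  assume f: "f \<in> hom ?C X Y"
  then obtain t where t: "f = (X, t, Y)" "X \<in> S" "Y \<in> S" "t \<in> N X Y"
    by (auto simp: hom_tagged_cat)
  show "AMap ?F f \<in> hom ?D (OMap ?F X) (OMap ?F Y)"
    using f t j by (simp add: hom_tagged_cat)
  assume g: "g \<in> hom ?C Y Z"
  then obtain s where s: "g = (Y, s, Z)" "Z \<in> S" "s \<in> N Y Z"
    by (auto simp: hom_tagged_cat)
  show "AMap ?F (Comp ?C g f) = Comp ?D (AMap ?F g) (AMap ?F f)"
    using AMap[of X t Y] AMap[of Y s Z] AMap[of X "m s t" Z] C.Comp_in_hom[OF f g] f g t s j_comp
    by simp
qed

text \<open>
  A hom-wise inverse of a functor is again functorial, so the laws for \<open>k\<close> follow from those for \<open>j\<close>.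
\<close>

lemma inverse_functors_tagged_cat:
  assumes cats: "category (tagged_cat S N e m)" "category (tagged_cat S N' e' m')"
    and j: "\<And>X Y t. \<lbrakk>X \<in> S; Y \<in> S; t \<in> N X Y\<rbrakk> \<Longrightarrow> j X Y t \<in> N' X Y"
    and k: "\<And>X Y t. \<lbrakk>X \<in> S; Y \<in> S; t \<in> N' X Y\<rbrakk> \<Longrightarrow> k X Y t \<in> N X Y"
    and kj: "\<And>X Y t. \<lbrakk>X \<in> S; Y \<in> S; t \<in> N X Y\<rbrakk> \<Longrightarrow> k X Y (j X Y t) = t"
    and jk: "\<And>X Y t. \<lbrakk>X \<in> S; Y \<in> S; t \<in> N' X Y\<rbrakk> \<Longrightarrow> j X Y (k X Y t) = t"
    and j_id: "\<And>X. X \<in> S \<Longrightarrow> j X X (e X) = e' X"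
    and j_comp: "\<And>X Y Z s t. \<lbrakk>X \<in> S; Y \<in> S; Z \<in> S; t \<in> N X Y; s \<in> N Y Z\<rbrakk>
      \<Longrightarrow> j X Z (m s t) = m' (j Y Z s) (j X Y t)"
  shows "inverse_functors (tagged_cat S N e m) (tagged_cat S N' e' m')
    \<lparr>OMap = (\<lambda>X\<in>S. X), AMap = (\<lambda>(X, t, Y) \<in> Arr (tagged_cat S N e m). (X, j X Y t, Y))\<rparr>
    \<lparr>OMap = (\<lambda>X\<in>S. X), AMap = (\<lambda>(X, t, Y) \<in> Arr (tagged_cat S N' e' m'). (X, k X Y t, Y))\<rparr>"
    (is "inverse_functors ?C ?D ?F ?G")
proof -
  have e: "e X \<in> N X X" if "X \<in> S" for X
    using category.Id_in_hom[OF cats(1), of X] that by (simp add: hom_tagged_cat)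
  have m: "m s t \<in> N X Z" if "X \<in> S" "Y \<in> S" "Z \<in> S" "t \<in> N X Y" "s \<in> N Y Z" for X Y Z s t
    using category.Comp_in_hom[OF cats(1), of "(X, t, Y)" X Y "(Y, s, Z)" Z] that
    by (simp add: hom_tagged_cat)
  have k_id: "k X X (e' X) = e X" if "X \<in> S" for X
    using kj[OF that that e[OF that]] j_id[OF that] by simp
  have k_comp: "k X Z (m' s t) = m (k Y Z s) (k X Y t)"
    if XYZ: "X \<in> S" "Y \<in> S" "Z \<in> S" and t: "t \<in> N' X Y" and s: "s \<in> N' Y Z" for X Y Z s t
  proof -
    note kt = k[OF XYZ(1,2) t] and ks = k[OF XYZ(2,3) s]
    have "j X Z (m (k Y Z s) (k X Y t)) = m' s t"
      using j_comp[OF XYZ kt ks] jk[OF XYZ(1,2) t] jk[OF XYZ(2,3) s] by simp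
    then show ?thesis
      using kj[OF XYZ(1,3) m[OF XYZ kt ks]] by simp
  qed
  have "cat_functor ?C ?D ?F"
    by (rule functor_tagged_cat) (fact cats j j_id j_comp)+
  moreover have "cat_functor ?D ?C ?G"
    by (rule functor_tagged_cat) (fact cats k k_id k_comp)+
  moreover have "comp_ftr ?C ?G ?F = id_ftr ?C" "comp_ftr ?D ?F ?G = id_ftr ?D"
    by (auto simp: comp_ftr_def id_ftr_def compose_def fun_eq_iff restrict_def j k jk kj)
  ultimately show ?thesis
    by (simp add: inverse_functors_def)
qed

lemma Adj_l_tagged_cat:
  "Adj_l A B C = tagged_cat {X. left_sided_adjunction A B C X} (Nat_T A B C)
    (\<lambda>X. nat_id (prod_cat A B) C (TF X)) (nat_comp (prod_cat A B) C)"
  by (simp add: Adj_l_def tagged_cat_def)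

lemma Adj_r_tagged_cat:
  "Adj_r A B C = tagged_cat {X. left_sided_adjunction A B C X} (Nat_H A B C)
    (\<lambda>X. nat_id (prod_cat (op_cat A) C) B (HF X)) (\<lambda>\<psi> \<phi>. nat_comp (prod_cat (op_cat A) C) B \<phi> \<psi>)"
  by (simp add: Adj_r_def tagged_cat_def)

lemma category_Adj_l:
  assumes "category C"
  shows "category (Adj_l A B C)"
  unfolding Adj_l_tagged_cat
proof (rule category_tagged_cat, goal_cases)
  case 1
  then show ?case
    by (auto simp: Nat_T_def left_sided_adjunction_def intro: nat_id_in_Nat)
next
  case 2
  then show ?case by (auto intro: nat_comp_in_Nat_T)
next
  case 3
  then show ?case by (auto simp: Nat_T_def nat_comp_id[OF assms])
next
  case 4
  then show ?case by (auto simp: Nat_T_def intro: nat_comp_assoc[OF assms])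
qed

lemma category_Adj_r:
  assumes "category B"
  shows "category (Adj_r A B C)"
  unfolding Adj_r_tagged_cat
proof (rule category_tagged_cat, goal_cases)
  case 1
  then show ?case
    by (auto simp: Nat_H_def left_sided_adjunction_def intro: nat_id_in_Nat)
next
  case 2
  then show ?case by (auto intro: nat_comp_in_Nat_H)
next
  case 3
  then show ?case by (auto simp: Nat_H_def nat_comp_id[OF assms])
next
  case 4
  then show ?case by (auto simp: Nat_H_def intro: nat_comp_assoc[OF assms, symmetric])
qed

theorem proposition4p5:
  fixes A :: "('a, 'ma) cat" and B :: "('b, 'mb) cat" and C :: "('c, 'mc) cat"
  assumes "category A" and "category B" and "category C"
  shows "(\<forall>X Y. left_sided_adjunction A B C X \<and> left_sided_adjunction A B C Y \<longrightarrow>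
            conj_l A B C X Y \<in> Nat_T A B C X Y \<rightarrow> Nat_H A B C X Y \<and>
            conj_r A B C X Y \<in> Nat_H A B C X Y \<rightarrow> Nat_T A B C X Y)
    \<and> Obj (Adj_l A B C) = Obj (Adj_r A B C)
    \<and> (\<forall>X\<in>Obj (Adj_l A B C). OMap (J_l A B C) X = X \<and> OMap (J_r A B C) X = X)
    \<and> inverse_functors (Adj_l A B C) (Adj_r A B C) (J_l A B C) (J_r A B C)"
proof -
  let ?S = "{X. left_sided_adjunction A B C X}"
  have adj: "adjunction_2L A B C X" if "X \<in> ?S" for X
    using that assms by (simp add: adjunction_2L_def)
  have pair: "adjunction_2L_pair A B C X Y" if "X \<in> ?S" "Y \<in> ?S" for X Y
    using that adj by (simp add: adjunction_2L_pair_def)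
  have Obj: "Obj (Adj_l A B C) = ?S" "Obj (Adj_r A B C) = ?S"
    by (simp_all add: Adj_l_def Adj_r_def)
  have "inverse_functors (Adj_l A B C) (Adj_r A B C) (J_l A B C) (J_r A B C)"
    using category_Adj_l[OF assms(3), of A B] category_Adj_r[OF assms(2), of A C]
    unfolding J_l_def J_r_def Obj unfolding Adj_l_tagged_cat Adj_r_tagged_cat
    by (rule inverse_functors_tagged_cat)
      (simp_all add: pair[simplified] adj[simplified] adjunction_2L_pair.conj_l_in_Nat_H
        adjunction_2L_pair.conj_r_in_Nat_T adjunction_2L_pair.conj_r_conj_l
        adjunction_2L_pair.conj_l_conj_r adjunction_2L.conj_l_id conj_l_comp)
  moreover have "OMap (J_l A B C) X = X \<and> OMap (J_r A B C) X = X" if "X \<in> ?S" for X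
    using that by (simp add: J_l_def J_r_def Obj)
  ultimately show ?thesis
    using pair by (auto simp: Obj adjunction_2L_pair.conj_l_in_Nat_H adjunction_2L_pair.conj_r_in_Nat_T)
qed

end
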